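(* For every contextuality scenario with only trivial equivalences of preparations, $T=(X,Y,K,\emptyset,\mathcal{OE}_M)$, all behaviours are noncontextual, i.e. $\mathcal{NC}=\mathcal{Q}=\mathcal{C}$.
   Context: For a positive integer $N$, $[N]=\{0,\dots,N-1\}$. A contextuality scenario is a tuple $T=(X,Y,K,\mathcal{OE}_P,\mathcal{OE}_M)$ where $X,Y,K$ are positive integers (numbers of preparations, measurements, and outcomes per measurement), $\mathcal{OE}_P=\{\{\alpha^v_j\}_{j\in[V_v]}\}_{v\in[V]}$ is a finite (possibly empty) family in which each $\{\alpha^v_j\}_{j\in[V_v]}$ consists of $V_v\ge 2$ distinct probability distributions on $[X]$, and $\mathcal{OE}_M=\{\{\beta^w_j\}_{j\in[W_w]}\}_{w\in[W]}$ is a finite (possibly empty) family in which each $\{\beta^w_j\}_{j\in[W_w]}$ consists of $W_w\ge 2$ distinct probability distributions on $[K]\times[Y]$. $\mathcal{OE}_P=\emptyset$ means that no preparation equivalences are imposed ($V=0$). A behaviour is a vector $\mathbf{p}=(p(k|x,y))_{x\in[X],y\in[Y],k\in[K]}\in\mathbb{R}^{XYK}$ with $p(k|x,y)\ge 0$ and $\sum_k p(k|x,y)=1$ for all $x,y$. For a given scenario $T$: - $\mathcal{C}$ (contextual polytope) is the set of behaviours such that for all $y\in[Y],k\in[K],v\in[V]$ the number $\sum_x\alpha^v_j(x)p(k|x,y)$ is the same for all $j\in[V_v]$, and for all $x\in[X],w\in[W]$ the number $\sum_{k,y}\beta^w_j(k,y)p(k|x,y)$ is the same for all $j\in[W_w]$.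 - $\mathcal{Q}$ is the set of behaviours for which there exist a finite-dimensional complex Hilbert space $\mathcal{H}$, density operators $\rho_x$ ($x\in[X]$) and POVMs $\{M^y_k\}_{k\in[K]}$ ($y\in[Y]$) on $\mathcal{H}$ with $p(k|x,y)=\operatorname{tr}(\rho_xM^y_k)$, such that for every $v$ the operator $\sum_x\alpha^v_j(x)\rho_x$ is the same for all $j\in[V_v]$, and for every $w$ the operator $\sum_{k,y}\beta^w_j(k,y)M^y_k$ is the same for all $j\in[W_w]$. - $\mathcal{NC}$ (noncontextual polytope) is the set of behaviours for which there exist a measurable space $\Lambda$, probability measures $\mu_x$ on $\Lambda$ ($x\in[X]$), and measurable functions $\xi_y(k|\cdot):\Lambda\to[0,1]$ with $\sum_k\xi_y(k|\lambda)=1$ for all $\lambda\in\Lambda$, $y\in[Y]$, such that $p(k|x,y)=\int_\Lambda \xi_y(k|\lambda)\,d\mu_x(\lambda)$ for all $x,y,k$, for every $v$ the measure $\sum_x\alpha^v_j(x)\mu_x$ is the same for all $j\in[V_v]$, and for every $w$ the function $\sum_{k,y}\beta^w_j(k,y)\xi_y(k|\cdot)$ is the same for all $j\in[W_w]$. *)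

theory Defs
  imports
    "HOL-Probability.Probability"
    "Jordan_Normal_Form.Schur_Decomposition"
begin

text \<open>
  A distribution on \<open>[N]\<close> is a pmf on nat whose support lies in \<open>{..<N}\<close>, so that equality of
  pmfs is equality of distributions. A family of families is a list of lists; \<open>oe_prep T = []\<close>
  says that no preparation equivalences are imposed.
\<close>

record scenario =
  n_prep :: nat
  n_meas :: nat
  n_out :: nat
  oe_prep :: "nat pmf list list"
  oe_meas :: "(nat \<times> nat) pmf list list"

definition contextuality_scenario :: "scenario \<Rightarrow> bool" where
  "contextuality_scenario T \<longleftrightarrow>
     n_prep T > 0 \<and> n_meas T > 0 \<and> n_out T > 0 \<and>
     (\<forall>as \<in> set (oe_prep T). length as \<ge> 2 \<and> distinct as \<and>
        (\<forall>\<alpha> \<in> set as. set_pmf \<alpha> \<subseteq> {..<n_prep T})) \<and>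
     (\<forall>bs \<in> set (oe_meas T). length bs \<ge> 2 \<and> distinct bs \<and>
        (\<forall>\<beta> \<in> set bs. set_pmf \<beta> \<subseteq> {..<n_out T} \<times> {..<n_meas T}))"

text \<open>
  The entry \<open>p(k|x,y)\<close> of a behaviour is \<open>p (k, x, y)\<close>. Extensionality makes functions on
  \<open>[K] \<times> [X] \<times> [Y]\<close> correspond one-to-one to vectors with \<open>XYK\<close> real entries.
\<close>

definition behaviours :: "scenario \<Rightarrow> (nat \<times> nat \<times> nat \<Rightarrow> real) set" where
  "behaviours T = {p \<in> extensional ({..<n_out T} \<times> {..<n_prep T} \<times> {..<n_meas T}).
     \<forall>x<n_prep T. \<forall>y<n_meas T.
       (\<forall>k<n_out T. p (k, x, y) \<ge> 0) \<and> (\<Sum>k<n_out T. p (k, x, y)) = 1}"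

definition contextual_polytope :: "scenario \<Rightarrow> (nat \<times> nat \<times> nat \<Rightarrow> real) set" where
  "contextual_polytope T = {p \<in> behaviours T.
     (\<forall>y<n_meas T. \<forall>k<n_out T. \<forall>as \<in> set (oe_prep T). \<forall>\<alpha> \<in> set as. \<forall>\<alpha>' \<in> set as.
        (\<Sum>x<n_prep T. pmf \<alpha> x * p (k, x, y)) = (\<Sum>x<n_prep T. pmf \<alpha>' x * p (k, x, y))) \<and>
     (\<forall>x<n_prep T. \<forall>bs \<in> set (oe_meas T). \<forall>\<beta> \<in> set bs. \<forall>\<beta>' \<in> set bs.
        (\<Sum>k<n_out T. \<Sum>y<n_meas T. pmf \<beta> (k, y) * p (k, x, y)) =
        (\<Sum>k<n_out T. \<Sum>y<n_meas T. pmf \<beta>' (k, y) * p (k, x, y)))}"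

text \<open>Operators on the Hilbert space \<open>\<complex>\<^sup>d\<close> are complex \<open>d \<times> d\<close> matrices.\<close>

definition mat_trace :: "complex mat \<Rightarrow> complex" where
  "mat_trace A = (\<Sum>i<dim_row A. A $$ (i, i))"

definition lin_comb_mat :: "nat \<Rightarrow> 'i set \<Rightarrow> ('i \<Rightarrow> real) \<Rightarrow> ('i \<Rightarrow> complex mat) \<Rightarrow> complex mat" where
  "lin_comb_mat d I c A = Matrix.mat d d (\<lambda>(i, j). \<Sum>s\<in>I. complex_of_real (c s) * A s $$ (i, j))"

text \<open>In the order on \<open>\<complex>\<close> used here, \<open>0 \<le> z\<close> means that \<open>z\<close> is real and nonnegative.\<close>

definition psd_mat :: "nat \<Rightarrow> complex mat \<Rightarrow> bool" where
  "psd_mat d A \<longleftrightarrow> A \<in> carrier_mat d d \<and> mat_adjoint A = A \<and>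
     (\<forall>v \<in> carrier_vec d. 0 \<le> (A *\<^sub>v v) \<bullet>c v)"

definition density_operator :: "nat \<Rightarrow> complex mat \<Rightarrow> bool" where
  "density_operator d \<rho> \<longleftrightarrow> psd_mat d \<rho> \<and> mat_trace \<rho> = 1"

definition povm :: "nat \<Rightarrow> nat \<Rightarrow> (nat \<Rightarrow> complex mat) \<Rightarrow> bool" where
  "povm d K M \<longleftrightarrow> (\<forall>k<K. psd_mat d (M k)) \<and> lin_comb_mat d {..<K} (\<lambda>_. 1) M = 1\<^sub>m d"

definition quantum_set :: "scenario \<Rightarrow> (nat \<times> nat \<times> nat \<Rightarrow> real) set" where
  "quantum_set T = {p \<in> behaviours T.
     \<exists>(d :: nat) (\<rho> :: nat \<Rightarrow> complex mat) (M :: nat \<Rightarrow> nat \<Rightarrow> complex mat).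
       (\<forall>x<n_prep T. density_operator d (\<rho> x)) \<and>
       (\<forall>y<n_meas T. povm d (n_out T) (M y)) \<and>
       (\<forall>x<n_prep T. \<forall>y<n_meas T. \<forall>k<n_out T.
          complex_of_real (p (k, x, y)) = mat_trace (\<rho> x * M y k)) \<and>
       (\<forall>as \<in> set (oe_prep T). \<forall>\<alpha> \<in> set as. \<forall>\<alpha>' \<in> set as.
          lin_comb_mat d {..<n_prep T} (pmf \<alpha>) \<rho> = lin_comb_mat d {..<n_prep T} (pmf \<alpha>') \<rho>) \<and>
       (\<forall>bs \<in> set (oe_meas T). \<forall>\<beta> \<in> set bs. \<forall>\<beta>' \<in> set bs.
          lin_comb_mat d ({..<n_out T} \<times> {..<n_meas T}) (pmf \<beta>) (\<lambda>(k, y). M y k) =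
          lin_comb_mat d ({..<n_out T} \<times> {..<n_meas T}) (pmf \<beta>') (\<lambda>(k, y). M y k))}"

text \<open>
  HOL cannot quantify over all types inside a definition, so the type of which the measurable
  space \<open>\<Lambda> = space L\<close> is a subset is a parameter; only the measurable structure of \<open>L\<close> is used.
  Lemma \<open>noncontextual_polytope_mono\<close> shows that enlarging the type cannot lose behaviours.
  Every type embeds in an infinite one, so a statement about all infinite types accounts for
  measurable spaces on arbitrary types. (A finite type may be too small to carry a model.)
\<close>

definition noncontextual_polytope ::
    "'l itself \<Rightarrow> scenario \<Rightarrow> (nat \<times> nat \<times> nat \<Rightarrow> real) set" where
  "noncontextual_polytope _ T = {p \<in> behaviours T.
     \<exists>(L :: 'l measure) (\<mu> :: nat \<Rightarrow> 'l measure) (\<xi> :: nat \<Rightarrow> nat \<Rightarrow> 'l \<Rightarrow> real).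
       (\<forall>x<n_prep T. prob_space (\<mu> x) \<and> sets (\<mu> x) = sets L) \<and>
       (\<forall>y<n_meas T. \<forall>k<n_out T. \<xi> y k \<in> borel_measurable L) \<and>
       (\<forall>y<n_meas T. \<forall>l \<in> space L.
          (\<forall>k<n_out T. \<xi> y k l \<in> {0..1}) \<and> (\<Sum>k<n_out T. \<xi> y k l) = 1) \<and>
       (\<forall>x<n_prep T. \<forall>y<n_meas T. \<forall>k<n_out T. p (k, x, y) = (\<integral>l. \<xi> y k l \<partial>\<mu> x)) \<and>
       (\<forall>as \<in> set (oe_prep T). \<forall>\<alpha> \<in> set as. \<forall>\<alpha>' \<in> set as. \<forall>A \<in> sets L.
          (\<Sum>x<n_prep T. pmf \<alpha> x * measure (\<mu> x) A) =
          (\<Sum>x<n_prep T. pmf \<alpha>' x * measure (\<mu> x) A)) \<and>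
       (\<forall>bs \<in> set (oe_meas T). \<forall>\<beta> \<in> set bs. \<forall>\<beta>' \<in> set bs. \<forall>l \<in> space L.
          (\<Sum>k<n_out T. \<Sum>y<n_meas T. pmf \<beta> (k, y) * \<xi> y k l) =
          (\<Sum>k<n_out T. \<Sum>y<n_meas T. pmf \<beta>' (k, y) * \<xi> y k l))}"

lemma noncontextual_polytope_mono:
  fixes f :: "'m \<Rightarrow> 'l"
  assumes "inj f"
  shows "noncontextual_polytope TYPE('m) T \<subseteq> noncontextual_polytope TYPE('l) T"
proof
  fix p assume "p \<in> noncontextual_polytope TYPE('m) T"
  then obtain L :: "'m measure" and \<mu> \<xi> where p: "p \<in> behaviours T"
    and prob0: "\<forall>x<n_prep T. prob_space (\<mu> x) \<and> sets (\<mu> x) = sets L"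
    and meas0: "\<forall>y<n_meas T. \<forall>k<n_out T. \<xi> y k \<in> borel_measurable L"
    and resp0: "\<forall>y<n_meas T. \<forall>l \<in> space L.
          (\<forall>k<n_out T. \<xi> y k l \<in> {0..1}) \<and> (\<Sum>k<n_out T. \<xi> y k l) = 1"
    and int0: "\<forall>x<n_prep T. \<forall>y<n_meas T. \<forall>k<n_out T. p (k, x, y) = (\<integral>l. \<xi> y k l \<partial>\<mu> x)"
    and prep: "\<forall>as \<in> set (oe_prep T). \<forall>\<alpha> \<in> set as. \<forall>\<alpha>' \<in> set as. \<forall>A \<in> sets L.
          (\<Sum>x<n_prep T. pmf \<alpha> x * measure (\<mu> x) A) =
          (\<Sum>x<n_prep T. pmf \<alpha>' x * measure (\<mu> x) A)"
    and eqm: "\<forall>bs \<in> set (oe_meas T). \<forall>\<beta> \<in> set bs. \<forall>\<beta>' \<in> set bs. \<forall>l \<in> space L.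
          (\<Sum>k<n_out T. \<Sum>y<n_meas T. pmf \<beta> (k, y) * \<xi> y k l) =
          (\<Sum>k<n_out T. \<Sum>y<n_meas T. pmf \<beta>' (k, y) * \<xi> y k l)"
    unfolding noncontextual_polytope_def mem_Collect_eq by (elim conjE exE)
  have prob: "prob_space (\<mu> x)" and sets: "sets (\<mu> x) = sets L" if "x < n_prep T" for x
    using prob0 that by auto
  have meas: "\<xi> y k \<in> borel_measurable L" if "y < n_meas T" "k < n_out T" for y k
    using meas0 that by auto
  have resp: "(\<forall>k<n_out T. \<xi> y k l \<in> {0..1}) \<and> (\<Sum>k<n_out T. \<xi> y k l) = 1"
    if "y < n_meas T" "l \<in> space L" for y l
    using resp0 that by blast
  have int: "p (k, x, y) = (\<integral>l. \<xi> y k l \<partial>\<mu> x)"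
    if "x < n_prep T" "y < n_meas T" "k < n_out T" for x y k
    using int0 that by blast
  have inv: "inv_into UNIV f (f a) = a" for a
    using assms by simp
  define L' where "L' = embed_measure L f"
  define \<mu>' where "\<mu>' = (\<lambda>x. distr (\<mu> x) L' f)"
  define \<xi>' where "\<xi>' = (\<lambda>y k l. \<xi> y k (inv_into UNIV f l))"
  have fL: "f \<in> measurable L L'"
    unfolding L'_def by (rule measurable_embed_measure2[OF assms])
  have gL: "inv_into UNIV f \<in> measurable L' L"
    unfolding L'_def by (rule measurable_embed_measure1) (simp add: inv)
  have spL': "space L' = f ` space L"
    by (simp add: L'_def space_embed_measure)
  have f\<mu>: "f \<in> measurable (\<mu> x) L'" if "x < n_prep T" for x
    using fL measurable_cong_sets[OF sets[OF that] refl, of L'] by simp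
  have m\<mu>: "measure (\<mu>' x) A = measure (\<mu> x) (f -` A \<inter> space L)"
    if "x < n_prep T" "A \<in> sets L'" for x A
    using measure_distr[OF f\<mu>[OF that(1)] that(2)] sets_eq_imp_space_eq[OF sets[OF that(1)]]
    by (simp add: \<mu>'_def)
  have meas': "\<xi>' y k \<in> borel_measurable L'" if "y < n_meas T" "k < n_out T" for y k
    using measurable_compose[OF gL meas[OF that]] by (simp add: \<xi>'_def)
  show "p \<in> noncontextual_polytope TYPE('l) T"
    unfolding noncontextual_polytope_def mem_Collect_eq
  proof (intro conjI exI[of _ L'] exI[of _ \<mu>'] exI[of _ \<xi>'] allI impI ballI)
    show "p \<in> behaviours T" by fact
  next
    fix x assume x: "x < n_prep T"
    show "prob_space (\<mu>' x)"
      unfolding \<mu>'_def by (rule prob_space.prob_space_distr[OF prob[OF x] f\<mu>[OF x]])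
    show "sets (\<mu>' x) = sets L'" by (simp add: \<mu>'_def)
  next
    fix y k assume "y < n_meas T" "k < n_out T"
    then show "\<xi>' y k \<in> borel_measurable L'" by (rule meas')
  next
    fix y l k assume "y < n_meas T" "l \<in> space L'" "k < n_out T"
    then show "\<xi>' y k l \<in> {0..1}"
      using resp unfolding \<xi>'_def spL' by (elim imageE) (simp only: inv)
  next
    fix y l assume "y < n_meas T" "l \<in> space L'"
    then show "(\<Sum>k<n_out T. \<xi>' y k l) = 1"
      using resp unfolding \<xi>'_def spL' by (elim imageE) (simp only: inv)
  next
    fix x y k assume x: "x < n_prep T" "y < n_meas T" "k < n_out T"
    have "(\<integral>l. \<xi>' y k l \<partial>\<mu>' x) = (\<integral>l. \<xi>' y k (f l) \<partial>\<mu> x)"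
      unfolding \<mu>'_def by (rule integral_distr[OF f\<mu>[OF x(1)] meas'[OF x(2,3)]])
    then show "p (k, x, y) = (\<integral>l. \<xi>' y k l \<partial>\<mu>' x)"
      using int[OF x] by (simp only: \<xi>'_def inv)
  next
    fix as \<alpha> \<alpha>' A
    assume as: "as \<in> set (oe_prep T)" "\<alpha> \<in> set as" "\<alpha>' \<in> set as" and A: "A \<in> sets L'"
    have "f -` A \<inter> space L \<in> sets L" using fL A by (rule measurable_sets)
    then have "(\<Sum>x<n_prep T. pmf \<alpha> x * measure (\<mu> x) (f -` A \<inter> space L)) =
          (\<Sum>x<n_prep T. pmf \<alpha>' x * measure (\<mu> x) (f -` A \<inter> space L))"
      using prep as by blast
    then show "(\<Sum>x<n_prep T. pmf \<alpha> x * measure (\<mu>' x) A) =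
          (\<Sum>x<n_prep T. pmf \<alpha>' x * measure (\<mu>' x) A)"
      using A by (simp add: m\<mu>)
  next
    fix bs \<beta> \<beta>' l
    assume bs: "bs \<in> set (oe_meas T)" "\<beta> \<in> set bs" "\<beta>' \<in> set bs" and "l \<in> space L'"
    then obtain a where a: "a \<in> space L" "l = f a" unfolding spL' by (elim imageE)
    show "(\<Sum>k<n_out T. \<Sum>y<n_meas T. pmf \<beta> (k, y) * \<xi>' y k l) =
          (\<Sum>k<n_out T. \<Sum>y<n_meas T. pmf \<beta>' (k, y) * \<xi>' y k l)"
      using eqm bs a(1) unfolding \<xi>'_def a(2) inv by blast
  qed
qed

end

theory Submission
  imports Defs
begin

text \<open>
  Without preparation equivalences the preparation label itself can serve as the hidden variable:
  put \<open>\<Lambda> = [X]\<close>, let \<open>\<mu>\<^sub>x\<close> be the point mass at \<open>x\<close> and \<open>\<xi>\<^sub>y(k|x) = p(k|x,y)\<close>. The measurement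
  equivalences of \<open>\<xi>\<close> are then literally those of \<open>p\<close>. The diagonal version of this model
  (\<open>\<rho>\<^sub>x = |x\<rangle>\<langle>x|\<close>, \<open>M\<^sup>y\<^sub>k = diag (p(k|x,y))\<^sub>x\<close>) is a quantum model. The converse inclusions hold because
  the trace and the integral are linear.
\<close>

lemma mat_trace_mult:
  assumes "A \<in> carrier_mat d d" "B \<in> carrier_mat d d"
  shows "mat_trace (A * B) = (\<Sum>i<d. \<Sum>j<d. A $$ (i, j) * B $$ (j, i))"
  using assms by (simp add: mat_trace_def scalar_prod_def atLeast0LessThan)

lemma lin_comb_mat_carrier [simp]: "lin_comb_mat d I c A \<in> carrier_mat d d"
  by (simp add: lin_comb_mat_def)

text \<open>With its mirror image below, this makes \<open>mat_trace (A * B)\<close> bilinear, so an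
  equality of mixed operators becomes an equality of mixed probabilities.\<close>

lemma mat_trace_mult_lin_comb_right:
  assumes A: "A \<in> carrier_mat d d" and B: "\<And>s. s \<in> I \<Longrightarrow> B s \<in> carrier_mat d d"
  shows "mat_trace (A * lin_comb_mat d I c B) = (\<Sum>s\<in>I. complex_of_real (c s) * mat_trace (A * B s))"
proof -
  have "mat_trace (A * lin_comb_mat d I c B)
      = (\<Sum>i<d. \<Sum>j<d. \<Sum>s\<in>I. complex_of_real (c s) * (A $$ (i, j) * B s $$ (j, i)))"
    by (simp add: mat_trace_mult[OF A] lin_comb_mat_def sum_distrib_left ac_simps)
  also have "\<dots> = (\<Sum>i<d. \<Sum>s\<in>I. \<Sum>j<d. complex_of_real (c s) * (A $$ (i, j) * B s $$ (j, i)))"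
    by (intro sum.cong refl sum.swap)
  also have "\<dots> = (\<Sum>s\<in>I. \<Sum>i<d. \<Sum>j<d. complex_of_real (c s) * (A $$ (i, j) * B s $$ (j, i)))"
    by (rule sum.swap)
  also have "\<dots> = (\<Sum>s\<in>I. complex_of_real (c s) * mat_trace (A * B s))"
    by (intro sum.cong refl) (simp add: mat_trace_mult[OF A B] sum_distrib_left)
  finally show ?thesis .
qed

lemma mat_trace_mult_lin_comb_left:
  assumes A: "A \<in> carrier_mat d d" and B: "\<And>s. s \<in> I \<Longrightarrow> B s \<in> carrier_mat d d"
  shows "mat_trace (lin_comb_mat d I c B * A) = (\<Sum>s\<in>I. complex_of_real (c s) * mat_trace (B s * A))"
proof -
  \<comment> \<open>Cyclicity of the trace: the two double sums differ only in the order of the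
    indices. It moves the mixture to the right factor.\<close>
  have comm: "mat_trace (C * A) = mat_trace (A * C)" if "C \<in> carrier_mat d d" for C
    unfolding mat_trace_mult[OF that A] mat_trace_mult[OF A that]
    by (subst sum.swap) (simp add: mult.commute)
  show ?thesis
    using mat_trace_mult_lin_comb_right[OF A B] by (simp add: comm B)
qed

text \<open>An equivalence equates two mixed operators; pairing both under the trace with one fixed
  effect (for preparations) or one fixed state (for measurements) gives the required equality of
  probabilities.\<close>

lemma quantum_set_subset_contextual_polytope: "quantum_set T \<subseteq> contextual_polytope T"
proof
  fix p assume "p \<in> quantum_set T"
  then obtain d \<rho> M where p: "p \<in> behaviours T"
    and dens: "\<forall>x<n_prep T. density_operator d (\<rho> x)"
    and povm: "\<forall>y<n_meas T. povm d (n_out T) (M y)"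
    and tr: "\<forall>x<n_prep T. \<forall>y<n_meas T. \<forall>k<n_out T.
          complex_of_real (p (k, x, y)) = mat_trace (\<rho> x * M y k)"
    and prep: "\<forall>as \<in> set (oe_prep T). \<forall>\<alpha> \<in> set as. \<forall>\<alpha>' \<in> set as.
          lin_comb_mat d {..<n_prep T} (pmf \<alpha>) \<rho> = lin_comb_mat d {..<n_prep T} (pmf \<alpha>') \<rho>"
    and meas: "\<forall>bs \<in> set (oe_meas T). \<forall>\<beta> \<in> set bs. \<forall>\<beta>' \<in> set bs.
          lin_comb_mat d ({..<n_out T} \<times> {..<n_meas T}) (pmf \<beta>) (\<lambda>(k, y). M y k) =
          lin_comb_mat d ({..<n_out T} \<times> {..<n_meas T}) (pmf \<beta>') (\<lambda>(k, y). M y k)"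
    unfolding quantum_set_def mem_Collect_eq by (elim conjE exE)
  have \<rho>: "\<rho> x \<in> carrier_mat d d" if "x < n_prep T" for x
    using dens that by (simp add: density_operator_def psd_mat_def)
  have M: "M y k \<in> carrier_mat d d" if "y < n_meas T" "k < n_out T" for y k
    using povm that by (simp add: povm_def psd_mat_def)
  \<comment> \<open>The Born rule extended to mixtures. The weights \<open>c\<close> stay arbitrary
    so that both members of an equivalence are instances.\<close>
  have mix_prep: "complex_of_real (\<Sum>x<n_prep T. c x * p (k, x, y))
      = mat_trace (lin_comb_mat d {..<n_prep T} c \<rho> * M y k)"
    if "y < n_meas T" "k < n_out T" for y k c
    using that by (subst mat_trace_mult_lin_comb_left) (auto simp: M \<rho> tr)
  have mix_meas: "complex_of_real (\<Sum>k<n_out T. \<Sum>y<n_meas T. c (k, y) * p (k, x, y))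
      = mat_trace (\<rho> x * lin_comb_mat d ({..<n_out T} \<times> {..<n_meas T}) c (\<lambda>(k, y). M y k))"
    if "x < n_prep T" for x c
    using that by (subst mat_trace_mult_lin_comb_right) (auto simp: M \<rho> tr sum.cartesian_product intro!: sum.cong)
  show "p \<in> contextual_polytope T"
    unfolding contextual_polytope_def mem_Collect_eq
  proof (intro conjI allI impI ballI)
    show "p \<in> behaviours T" by fact
  next
    fix y k as \<alpha> \<alpha>'
    assume *: "y < n_meas T" "k < n_out T" "as \<in> set (oe_prep T)" "\<alpha> \<in> set as" "\<alpha>' \<in> set as"
    then have "lin_comb_mat d {..<n_prep T} (pmf \<alpha>) \<rho> = lin_comb_mat d {..<n_prep T} (pmf \<alpha>') \<rho>"
      using prep by blast
    then show "(\<Sum>x<n_prep T. pmf \<alpha> x * p (k, x, y)) = (\<Sum>x<n_prep T. pmf \<alpha>' x * p (k, x, y))"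
      \<comment> \<open>The traces are complex numbers; injectivity of the embedding of the reals
        brings the equality back to probabilities.\<close>
      by (intro of_real_eq_iff[where 'a = complex, THEN iffD1]) (simp only: mix_prep[OF *(1,2)])
  next
    fix x bs \<beta> \<beta>'
    assume *: "x < n_prep T" "bs \<in> set (oe_meas T)" "\<beta> \<in> set bs" "\<beta>' \<in> set bs"
    then have "lin_comb_mat d ({..<n_out T} \<times> {..<n_meas T}) (pmf \<beta>) (\<lambda>(k, y). M y k) =
        lin_comb_mat d ({..<n_out T} \<times> {..<n_meas T}) (pmf \<beta>') (\<lambda>(k, y). M y k)"
      using meas by blast
    then show "(\<Sum>k<n_out T. \<Sum>y<n_meas T. pmf \<beta> (k, y) * p (k, x, y)) =
        (\<Sum>k<n_out T. \<Sum>y<n_meas T. pmf \<beta>' (k, y) * p (k, x, y))"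
      by (intro of_real_eq_iff[where 'a = complex, THEN iffD1]) (simp only: mix_meas[OF *(1)])
  qed
qed

text \<open>A measurement equivalence holds pointwise in the hidden variable, so integrating it
  against \<mu>\<open>\<^sub>x\<close> gives the equivalence for \<open>p\<close>. The preparation
  clause is vacuous here.\<close>

lemma noncontextual_polytope_subset_contextual_polytope:
  assumes "oe_prep T = []"
  shows "noncontextual_polytope TYPE('l) T \<subseteq> contextual_polytope T"
proof
  fix p assume "p \<in> noncontextual_polytope TYPE('l) T"
  then obtain L :: "'l measure" and \<mu> \<xi> where p: "p \<in> behaviours T"
    and prob: "\<forall>x<n_prep T. prob_space (\<mu> x) \<and> sets (\<mu> x) = sets L"
    and meas: "\<forall>y<n_meas T. \<forall>k<n_out T. \<xi> y k \<in> borel_measurable L"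
    and resp: "\<forall>y<n_meas T. \<forall>l \<in> space L.
          (\<forall>k<n_out T. \<xi> y k l \<in> {0..1}) \<and> (\<Sum>k<n_out T. \<xi> y k l) = 1"
    and int: "\<forall>x<n_prep T. \<forall>y<n_meas T. \<forall>k<n_out T. p (k, x, y) = (\<integral>l. \<xi> y k l \<partial>\<mu> x)"
    and eqm: "\<forall>bs \<in> set (oe_meas T). \<forall>\<beta> \<in> set bs. \<forall>\<beta>' \<in> set bs. \<forall>l \<in> space L.
          (\<Sum>k<n_out T. \<Sum>y<n_meas T. pmf \<beta> (k, y) * \<xi> y k l) =
          (\<Sum>k<n_out T. \<Sum>y<n_meas T. pmf \<beta>' (k, y) * \<xi> y k l)"
    unfolding noncontextual_polytope_def mem_Collect_eq by (elim conjE exE)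
  have space: "space (\<mu> x) = space L" if "x < n_prep T" for x
    using prob that by (auto dest: sets_eq_imp_space_eq)
  \<comment> \<open>A response function is bounded by 1 on a probability space. Integrability has to
    be secured before integral and sum are exchanged, because a non-integrable function has integral
    0 by convention.\<close>
  have integrable: "integrable (\<mu> x) (\<xi> y k)"
    if x: "x < n_prep T" and y: "y < n_meas T" and k: "k < n_out T" for x y k
  proof -
    interpret prob_space "\<mu> x" using prob x by blast
    have "\<xi> y k \<in> borel_measurable (\<mu> x)"
      using meas prob x y k measurable_cong_sets[of "\<mu> x" L borel borel] by auto
    moreover have "AE l in \<mu> x. norm (\<xi> y k l) \<le> 1"
      using resp y k by (intro AE_I2) (auto simp: space[OF x])
    ultimately show ?thesis by (intro integrable_const_bound)
  qed
  have mix: "(\<Sum>k<n_out T. \<Sum>y<n_meas T. c (k, y) * p (k, x, y))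
      = (\<integral>l. (\<Sum>k<n_out T. \<Sum>y<n_meas T. c (k, y) * \<xi> y k l) \<partial>\<mu> x)"
    if x: "x < n_prep T" for x c
  proof -
    have "integrable (\<mu> x) (\<lambda>l. c (k, y) * \<xi> y k l)"
      if "k \<in> {..<n_out T}" "y \<in> {..<n_meas T}" for y k
      using x that by (intro integrable_mult_right integrable) auto
    then have "(\<integral>l. (\<Sum>k<n_out T. \<Sum>y<n_meas T. c (k, y) * \<xi> y k l) \<partial>\<mu> x)
        = (\<Sum>k<n_out T. \<Sum>y<n_meas T. \<integral>l. c (k, y) * \<xi> y k l \<partial>\<mu> x)"
      by (simp only: Bochner_Integration.integral_sum Bochner_Integration.integrable_sum cong: sum.cong)
    then show ?thesis
      using int x by simp
  qed
  show "p \<in> contextual_polytope T"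
    unfolding contextual_polytope_def mem_Collect_eq
  proof (intro conjI allI impI ballI)
    show "p \<in> behaviours T" by fact
  next
    fix x bs \<beta> \<beta>'
    assume x: "x < n_prep T" and bs: "bs \<in> set (oe_meas T)" "\<beta> \<in> set bs" "\<beta>' \<in> set bs"
    show "(\<Sum>k<n_out T. \<Sum>y<n_meas T. pmf \<beta> (k, y) * p (k, x, y)) =
        (\<Sum>k<n_out T. \<Sum>y<n_meas T. pmf \<beta>' (k, y) * p (k, x, y))"
      unfolding mix[OF x]
    proof (intro Bochner_Integration.integral_cong refl)
      fix l assume "l \<in> space (\<mu> x)"
      then have "l \<in> space L" by (simp only: space[OF x])
      then show "(\<Sum>k<n_out T. \<Sum>y<n_meas T. pmf \<beta> (k, y) * \<xi> y k l) =
          (\<Sum>k<n_out T. \<Sum>y<n_meas T. pmf \<beta>' (k, y) * \<xi> y k l)"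
        using eqm bs by blast
    qed
  qed (simp add: assms)
qed

text \<open>Preparation labels are natural numbers, so the model with \<Lambda> = [X] lives on
  \<open>nat\<close> first and is moved to other types afterwards.\<close>

lemma contextual_polytope_subset_noncontextual_polytope_nat:
  assumes "oe_prep T = []"
  shows "contextual_polytope T \<subseteq> noncontextual_polytope TYPE(nat) T"
proof
  fix p assume p: "p \<in> contextual_polytope T"
  then have beh: "p \<in> behaviours T" by (simp add: contextual_polytope_def)
  then have nonneg: "0 \<le> p (k, x, y)"
    if "k < n_out T" "x < n_prep T" "y < n_meas T" for k x y
    using that by (auto simp: behaviours_def)
  have norm: "(\<Sum>k<n_out T. p (k, x, y)) = 1" if "x < n_prep T" "y < n_meas T" for x y
    using beh that by (auto simp: behaviours_def)
  have le1: "p (k, x, y) \<le> 1" if "k < n_out T" "x < n_prep T" "y < n_meas T" for k x y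
    using member_le_sum[of k "{..<n_out T}" "\<lambda>k. p (k, x, y)"] that nonneg norm by auto
  \<comment> \<open>The restriction to labels below \<open>n_prep T\<close> matters: beyond them
    \<open>p\<close> is \<open>undefined\<close>, and normalisation and the equivalences could fail.
    In the counting space every function is measurable.\<close>
  define L where "L = count_space {..<n_prep T}"
  show "p \<in> noncontextual_polytope TYPE(nat) T"
    unfolding noncontextual_polytope_def mem_Collect_eq
  proof (intro conjI exI[of _ L] exI[of _ "return L"] exI[of _ "\<lambda>y k x. p (k, x, y)"] allI impI ballI)
    \<comment> \<open>Integrating against the point mass at \<open>x\<close> evaluates the response
      function there.\<close>
    fix x y k assume "x < n_prep T" "y < n_meas T" "k < n_out T"
    then show "p (k, x, y) = (\<integral>l. p (k, l, y) \<partial>return L x)"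
      by (subst integral_return) (auto simp: L_def)
  next
    fix bs \<beta> \<beta>' l
    assume "bs \<in> set (oe_meas T)" "\<beta> \<in> set bs" "\<beta>' \<in> set bs" "l \<in> space L"
    moreover from \<open>l \<in> space L\<close> have "l < n_prep T" by (simp add: L_def)
    ultimately show "(\<Sum>k<n_out T. \<Sum>y<n_meas T. pmf \<beta> (k, y) * p (k, l, y)) =
        (\<Sum>k<n_out T. \<Sum>y<n_meas T. pmf \<beta>' (k, y) * p (k, l, y))"
      using p unfolding contextual_polytope_def by blast
  qed (use assms in \<open>auto simp: L_def beh nonneg norm le1 intro!: prob_space_return\<close>)
qed

lemma contextual_polytope_subset_noncontextual_polytope:
  assumes "oe_prep T = []" and "infinite (UNIV :: 'l set)"
  shows "contextual_polytope T \<subseteq> noncontextual_polytope TYPE('l) T"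
proof -
  \<comment> \<open>An infinite type contains a copy of \<open>nat\<close>, along which
    \<open>noncontextual_polytope_mono\<close> pushes the model forward.\<close>
  obtain f :: "nat \<Rightarrow> 'l" where "inj f"
    using infinite_countable_subset[OF assms(2)] by blast
  then show ?thesis
    using contextual_polytope_subset_noncontextual_polytope_nat[OF assms(1)]
      noncontextual_polytope_mono by blast
qed

text \<open>The quadratic form at \<open>v\<close> is the sum of the \<open>f i\<close> weighted by
  the squared moduli of the coordinates of \<open>v\<close>.\<close>

lemma psd_mat_diag:
  assumes "\<And>i. i < d \<Longrightarrow> 0 \<le> f i"
  shows "psd_mat d (mat_diag d (\<lambda>i. complex_of_real (f i)))"
  unfolding psd_mat_def
proof (intro conjI ballI)
  show "mat_adjoint (mat_diag d (\<lambda>i. complex_of_real (f i))) = mat_diag d (\<lambda>i. complex_of_real (f i))"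
    by (rule eq_matI) (auto simp: mat_adjoint_def mat_of_rows_index mat_diag_def)
next
  fix v :: "complex vec" assume v: "v \<in> carrier_vec d"
  have "(mat_diag d (\<lambda>i. complex_of_real (f i)) *\<^sub>v v) $ i = complex_of_real (f i) * v $ i"
    if "i < d" for i
    using that v by (simp add: mat_diag_def scalar_prod_def if_distrib[of "\<lambda>z. z * _"] sum.delta cong: if_cong)
  \<comment> \<open>Each summand is kept as a single embedded real, since the order on the complex
    numbers also requires the imaginary part to vanish.\<close>
  then have "(mat_diag d (\<lambda>i. complex_of_real (f i)) *\<^sub>v v) \<bullet>c v
      = (\<Sum>i<d. complex_of_real (f i * (norm (v $ i))\<^sup>2))"
    using v by (simp add: scalar_prod_def atLeast0LessThan complex_norm_square mult.assoc del: of_real_power)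
  also have "0 \<le> \<dots>"
    using assms by (intro sum_nonneg) (simp add: less_eq_complex_def)
  finally show "0 \<le> (mat_diag d (\<lambda>i. complex_of_real (f i)) *\<^sub>v v) \<bullet>c v" .
qed (simp add: mat_diag_def)

text \<open>Operator equations between mixtures of diagonal matrices thereby reduce to one real
  equation per diagonal entry, that is, per preparation label.\<close>

lemma lin_comb_mat_diag:
  "lin_comb_mat d I c (\<lambda>s. mat_diag d (\<lambda>i. complex_of_real (f s i)))
     = mat_diag d (\<lambda>i. complex_of_real (\<Sum>s\<in>I. c s * f s i))"
  by (rule eq_matI) (auto simp: lin_comb_mat_def mat_diag_def)

lemma mat_trace_diag: "mat_trace (mat_diag d f) = (\<Sum>i<d. f i)"
  by (simp add: mat_trace_def mat_diag_def)

lemma contextual_polytope_subset_quantum_set: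
  assumes "oe_prep T = []"
  shows "contextual_polytope T \<subseteq> quantum_set T"
proof
  fix p assume p: "p \<in> contextual_polytope T"
  then have beh: "p \<in> behaviours T" by (simp add: contextual_polytope_def)
  \<comment> \<open>One basis vector per preparation.\<close>
  define d where "d = n_prep T"
  \<comment> \<open>The projector onto basis vector \<open>x\<close>, written with an embedded real
    diagonal so that \<open>psd_mat_diag\<close> applies.\<close>
  define \<rho> where "\<rho> = (\<lambda>x. mat_diag d (\<lambda>i. complex_of_real (if i = x then 1 else 0)))"
  define M where "M = (\<lambda>y k. mat_diag d (\<lambda>i. complex_of_real (p (k, i, y))))"
  show "p \<in> quantum_set T"
    unfolding quantum_set_def mem_Collect_eq
  proof (intro conjI exI[of _ d] exI[of _ \<rho>] exI[of _ M] allI impI ballI)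
    show "p \<in> behaviours T" by fact
  next
    fix x assume "x < n_prep T"
    then have "mat_trace (\<rho> x) = 1"
      by (simp add: \<rho>_def mat_trace_diag d_def if_distrib[of complex_of_real] cong: if_cong)
    then show "density_operator d (\<rho> x)"
      unfolding density_operator_def by (simp add: \<rho>_def psd_mat_diag del: of_real_eq_0_iff)
  next
    fix y assume y: "y < n_meas T"
    have "psd_mat d (M y k)" if "k < n_out T" for k
      unfolding M_def using beh y that by (intro psd_mat_diag) (simp add: behaviours_def d_def)
    \<comment> \<open>Entry \<open>i\<close> of the summed diagonal is the normalisation of
      \<open>p\<close> at preparation \<open>i\<close>.\<close>
    moreover have "lin_comb_mat d {..<n_out T} (\<lambda>_. 1) (M y) = 1\<^sub>m d"
      unfolding M_def lin_comb_mat_diag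
      using beh y by (intro eq_matI) (auto simp: behaviours_def d_def mat_diag_def simp flip: of_real_sum)
    ultimately show "povm d (n_out T) (M y)"
      by (simp add: povm_def)
  next
    fix x y k assume "x < n_prep T" "y < n_meas T" "k < n_out T"
    \<comment> \<open>The product is again diagonal, and its only possibly nonzero entry is
      \<open>p (k, x, y)\<close> at position \<open>x\<close>.\<close>
    then show "complex_of_real (p (k, x, y)) = mat_trace (\<rho> x * M y k)"
      by (simp add: \<rho>_def M_def mat_diag_diag mat_trace_diag d_def
          if_distrib[of complex_of_real] if_distrib[of "\<lambda>z. z * _"] cong: if_cong)
  next
    fix bs \<beta> \<beta>' assume *: "bs \<in> set (oe_meas T)" "\<beta> \<in> set bs" "\<beta>' \<in> set bs"
    have lin: "lin_comb_mat d ({..<n_out T} \<times> {..<n_meas T}) c (\<lambda>(k, y). M y k)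
        = mat_diag d (\<lambda>i. complex_of_real (\<Sum>k<n_out T. \<Sum>y<n_meas T. c (k, y) * p (k, i, y)))" for c
      using lin_comb_mat_diag[of d "{..<n_out T} \<times> {..<n_meas T}" c "\<lambda>(k, y) i. p (k, i, y)"]
      by (simp add: M_def case_prod_unfold sum.cartesian_product)
    \<comment> \<open>The defining equation of the contextual polytope, with the diagonal index
      \<open>i\<close> in the role of the preparation.\<close>
    have "(\<Sum>k<n_out T. \<Sum>y<n_meas T. pmf \<beta> (k, y) * p (k, i, y))
        = (\<Sum>k<n_out T. \<Sum>y<n_meas T. pmf \<beta>' (k, y) * p (k, i, y))" if "i < d" for i
      using p * that unfolding contextual_polytope_def d_def by blast
    then show "lin_comb_mat d ({..<n_out T} \<times> {..<n_meas T}) (pmf \<beta>) (\<lambda>(k, y). M y k) =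
        lin_comb_mat d ({..<n_out T} \<times> {..<n_meas T}) (pmf \<beta>') (\<lambda>(k, y). M y k)"
      unfolding lin by (intro eq_matI) (auto simp: mat_diag_def simp del: of_real_sum)
  qed (use assms in simp)
qed

theorem mainTheorem3:
  fixes T :: scenario
  assumes "contextuality_scenario T"
    and "oe_prep T = []"
    and "infinite (UNIV :: 'l set)"
  shows "noncontextual_polytope TYPE('l) T = quantum_set T \<and>
         quantum_set T = contextual_polytope T"
  \<comment> \<open>The noncontextual and the quantum set are each identified with the contextual
    polytope; they are never compared directly.\<close>
  using quantum_set_subset_contextual_polytope
    noncontextual_polytope_subset_contextual_polytope[OF assms(2)]
    contextual_polytope_subset_quantum_set[OF assms(2)]
    contextual_polytope_subset_noncontextual_polytope[OF assms(2,3)]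
  by blast

end
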